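(* Let $A\subset\mathbb C$, let $\Omega$ be an open neighbourhood of $0$, let $\Phi$ be a conformal map on $\Omega$ with $\Phi(0)=0$, and let $B$ be a planar Brownian motion started at $0$. Let $B^\Omega$ be $B$ stopped at its first hitting of $\partial\Omega$; by conformal invariance, $\Phi(B^\Omega)$ is (up to a time change) a Brownian path stopped at its first hitting of $\partial\Phi(\Omega)$. Then (almost surely) $$\tilde{\mathcal E}_A(\Phi(B^\Omega))=\Phi\big(\tilde{\mathcal E}_A(B^\Omega)\big).$$
   Context: For a continuous path $X$ defined on a time interval from $0$ up to time $\tau$, and for $0<t<\tau$, $r>0$, let $T_r(t)=\inf\{s>t:|X_s-X_t|=r\}$ and $S_r(t)=\sup\{s<t:|X_s-X_t|=r\}$ (which are defined for small $r$ when $X$ is not constant on any interval). For small $R>0$ put $$Z_t^R(X)=\bigcup_{0<\varepsilon<R}\Big\{\frac{X_s-X_t}{X_{s'}-X_t}: s\in[T_\varepsilon(t),T_R(t)],\ s'\in[S_R(t),S_\varepsilon(t)],\ X_{s'}\ne X_t\Big\},\qquad \tilde Z_t(X)=\bigcap_{R>0}\overline{Z_t^R(X)}.$$ The set of $A$-strongly exceptional points of $X$ is $\tilde{\mathcal E}_A(X)=\{X_t:0<t<\tau,\ \tilde Z_t(X)\cap A=\varnothing\}$; it does not depend on the time parametrization of $X$. For the stopped paths, $\tau$ is the first hitting time of the boundary. A conformal map is an injective holomorphic map. *)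

theory Defs
  imports "HOL-Probability.Probability" "HOL-Complex_Analysis.Complex_Analysis"
begin

locale planar_brownian_motion = prob_space M
  for M :: "'w measure" and B :: "real \<Rightarrow> 'w \<Rightarrow> complex" +
  assumes measurable_marginal: "\<And>t. 0 \<le> t \<Longrightarrow> B t \<in> borel_measurable M"
    and starts_at_0: "AE \<omega> in M. B 0 \<omega> = 0"
    and continuous_paths: "AE \<omega> in M. continuous_on {0..} (\<lambda>t. B t \<omega>)"
    and gaussian_increments: "\<And>s t. 0 \<le> s \<Longrightarrow> s < t \<Longrightarrow>
      distributed M lborel (\<lambda>\<omega>. B t \<omega> - B s \<omega>)
        (\<lambda>z. ennreal (exp (- (cmod z)\<^sup>2 / (2 * (t - s))) / (2 * pi * (t - s))))"
    and independent_increments: "\<And>(n::nat) (t :: nat \<Rightarrow> real).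
      0 \<le> t 0 \<Longrightarrow> (\<forall>i<n. t i < t (Suc i)) \<Longrightarrow>
      indep_vars (\<lambda>_. borel) (\<lambda>i \<omega>. B (t (Suc i)) \<omega> - B (t i) \<omega>) {..<n}"

text \<open>
  A path with time interval \<open>[0, \<tau>)\<close>, where \<open>\<tau>\<close> may be infinite, is given by a function
  \<open>X :: real \<Rightarrow> complex\<close> together with its lifetime \<open>\<tau> :: ereal\<close>; the values of \<open>X\<close> outside
  \<open>[0, \<tau>)\<close> are irrelevant to the definitions below.
\<close>

text \<open>The value is \<open>\<infinity>\<close> if \<open>F\<close> is never hit.\<close>

definition first_hitting_time :: "(real \<Rightarrow> complex) \<Rightarrow> complex set \<Rightarrow> ereal" where
  "first_hitting_time X F = Inf (ereal ` {t. 0 \<le> t \<and> X t \<in> F})"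

definition times_after :: "(real \<Rightarrow> complex) \<Rightarrow> ereal \<Rightarrow> real \<Rightarrow> real \<Rightarrow> real set" where
  "times_after X \<tau> t r = {s. t < s \<and> ereal s < \<tau> \<and> cmod (X s - X t) = r}"

definition times_before :: "(real \<Rightarrow> complex) \<Rightarrow> real \<Rightarrow> real \<Rightarrow> real set" where
  "times_before X t r = {s. 0 \<le> s \<and> s < t \<and> cmod (X s - X t) = r}"

definition T_time :: "(real \<Rightarrow> complex) \<Rightarrow> ereal \<Rightarrow> real \<Rightarrow> real \<Rightarrow> real" where
  "T_time X \<tau> r t = Inf (times_after X \<tau> t r)"

definition S_time :: "(real \<Rightarrow> complex) \<Rightarrow> real \<Rightarrow> real \<Rightarrow> real" where
  "S_time X r t = Sup (times_before X t r)"

definition Z_set :: "(real \<Rightarrow> complex) \<Rightarrow> ereal \<Rightarrow> real \<Rightarrow> real \<Rightarrow> complex set" where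
  "Z_set X \<tau> R t = (\<Union>\<epsilon>\<in>{0<..<R}.
     {(X s - X t) / (X s' - X t) | s s'.
        s \<in> {T_time X \<tau> \<epsilon> t..T_time X \<tau> R t} \<and>
        s' \<in> {S_time X R t..S_time X \<epsilon> t} \<and> X s' \<noteq> X t})"

text \<open>
  The infimum and supremum defining \<open>T_time\<close> and \<open>S_time\<close> are meaningful only over nonempty
  sets, so the intersection runs over the radii for which both sets are nonempty. For a
  continuous path that is nonconstant on every interval, these are all sufficiently small
  \<open>R > 0\<close>: by the intermediate value theorem, with \<open>R\<close> every radius in \<open>(0, R)\<close> qualifies.
  Since \<open>Z_set\<close> is increasing in \<open>R\<close>, an upper bound on \<open>R\<close> does not change the
  intersection.
\<close>

definition Z_tilde :: "(real \<Rightarrow> complex) \<Rightarrow> ereal \<Rightarrow> real \<Rightarrow> complex set" where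
  "Z_tilde X \<tau> t =
     (\<Inter>R\<in>{R. 0 < R \<and> times_after X \<tau> t R \<noteq> {} \<and> times_before X t R \<noteq> {}}.
        closure (Z_set X \<tau> R t))"

definition strongly_exceptional_points ::
    "complex set \<Rightarrow> (real \<Rightarrow> complex) \<Rightarrow> ereal \<Rightarrow> complex set" where
  "strongly_exceptional_points A X \<tau> =
     {X t | t. 0 < t \<and> ereal t < \<tau> \<and> Z_tilde X \<tau> t \<inter> A = {}}"

end

theory Submission
  imports Defs
begin

text \<open>
  For a path that is nonconstant on every interval, \<open>T_\<epsilon>(t)\<close> and \<open>S_\<epsilon>(t)\<close> tend to \<open>t\<close> as
  \<open>\<epsilon> \<rightarrow> 0\<close>. Hence \<open>Z_tilde\<close> at time \<open>t\<close> consists of all limits of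
  \<open>(X s - X t) / (X s' - X t)\<close> as \<open>s \<down> t\<close> and \<open>s' \<up> t\<close>, with no reference to hitting
  times. Since \<open>\<Phi> z - \<Phi> w = g z * (z - w)\<close> with \<open>g\<close> continuous and nonzero at
  \<open>w\<close>, replacing \<open>X\<close> by \<open>\<Phi> \<circ> X\<close> multiplies these quotients by a factor tending to \<open>1\<close>, so
  \<open>Z_tilde\<close> is unchanged.
\<close>

section \<open>Continuous paths on their lifetime and local nonconstancy\<close>

definition lifetime_interval :: "ereal \<Rightarrow> real set" where
  "lifetime_interval \<tau> = {s. 0 \<le> s \<and> ereal s < \<tau>}"

text \<open>Comparing with the value at \<open>t\<close> itself, on each side separately, is the
  form needed for sufficiently small circles around \<open>X t\<close> to be met arbitrarily soon
  after and arbitrarily shortly before \<open>t\<close>.\<close>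

definition nonconstant_near :: "(real \<Rightarrow> complex) \<Rightarrow> real \<Rightarrow> bool" where
  "nonconstant_near X t \<longleftrightarrow>
     (\<forall>u>t. \<exists>s\<in>{t<..<u}. X s \<noteq> X t) \<and> (\<forall>u<t. \<exists>s\<in>{u<..<t}. X s \<noteq> X t)"

lemma lifetime_interval_between:
  "\<lbrakk>0 \<le> a; ereal b < \<tau>\<rbrakk> \<Longrightarrow> {a..b} \<subseteq> lifetime_interval \<tau>"
  unfolding lifetime_interval_def by (auto intro: le_less_trans[of _ "ereal b"])

lemma isCont_of_continuous_lifetime:
  fixes X :: "real \<Rightarrow> 'a :: topological_space"
  assumes "continuous_on (lifetime_interval \<tau>) X" "0 < t" "ereal t < \<tau>"
  shows "isCont X t"
proof -
  \<comment> \<open>The lifetime may be infinite, so continuity is restricted to a compact interval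
    \<open>{0..b}\<close> that has \<open>t\<close> in its interior.\<close>
  obtain b where b: "t < b" "ereal b < \<tau>"
    using ereal_dense2[OF assms(3)] by auto
  have "continuous_on {0..b} X"
    using continuous_on_subset[OF assms(1) lifetime_interval_between[of 0 b]] b by simp
  then show ?thesis
    using b assms(2) by (intro continuous_on_interior[of "{0..b}"]) auto
qed

section \<open>Hitting times of circles around a point of the path\<close>

lemma times_after_within:
  assumes "continuous_on {t..u} X" "t < u" "ereal u < \<tau>" "0 < r" "r \<le> cmod (X u - X t)"
  shows "times_after X \<tau> t r \<noteq> {}" "T_time X \<tau> r t \<le> u"
proof -
  \<comment> \<open>The distance to \<open>X t\<close> is 0 at \<open>t\<close> and at least
    \<open>r\<close> at \<open>u\<close>, so it takes the value \<open>r\<close> in between; since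
    \<open>0 < r\<close>, this happens strictly after \<open>t\<close>.\<close>
  have "continuous_on {t..u} (\<lambda>s. cmod (X s - X t))"
    by (intro continuous_intros assms)
  then obtain s where s: "t \<le> s" "s \<le> u" "cmod (X s - X t) = r"
    using IVT'[of "\<lambda>s. cmod (X s - X t)" t r u] assms by auto
  have "s \<noteq> t"
    using s assms(4) by auto
  moreover have "ereal s < \<tau>"
    using s assms(3) by (simp add: le_less_trans[of _ "ereal u"])
  ultimately have mem: "s \<in> times_after X \<tau> t r"
    using s by (auto simp: times_after_def)
  then show "times_after X \<tau> t r \<noteq> {}" by auto
  have "bdd_below (times_after X \<tau> t r)"
    by (rule bdd_belowI[of _ t]) (auto simp: times_after_def)
  then show "T_time X \<tau> r t \<le> u"
    using cInf_lower[OF mem] s unfolding T_time_def by auto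
qed

lemma times_before_within:
  assumes "continuous_on {u..t} X" "u < t" "0 \<le> u" "0 < r" "r \<le> cmod (X u - X t)"
  shows "times_before X t r \<noteq> {}" "u \<le> S_time X r t"
proof -
  have "continuous_on {u..t} (\<lambda>s. cmod (X s - X t))"
    by (intro continuous_intros assms)
  then obtain s where s: "u \<le> s" "s \<le> t" "cmod (X s - X t) = r"
    using IVT2'[of "\<lambda>s. cmod (X s - X t)" t r u] assms by auto
  have "s \<noteq> t"
    using s assms(4) by auto
  then have mem: "s \<in> times_before X t r"
    using s assms(3) by (auto simp: times_before_def)
  then show "times_before X t r \<noteq> {}" by auto
  have "bdd_above (times_before X t r)"
    by (rule bdd_aboveI[of _ t]) (auto simp: times_before_def)
  then show "u \<le> S_time X r t"
    using cSup_upper[OF mem] s unfolding S_time_def by auto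
qed

lemma isCont_close:
  fixes X :: "real \<Rightarrow> complex"
  assumes "isCont X t" "0 < r"
  obtains d where "0 < d" "\<And>s. \<bar>s - t\<bar> < d \<Longrightarrow> cmod (X s - X t) < r"
  using assms unfolding continuous_at_eps_delta dist_norm real_norm_def by blast

text \<open>By continuity the path stays within distance less than \<open>r\<close> of
  \<open>X t\<close> during some time \<open>d\<close>, which bounds all hitting times away from
  \<open>t\<close>. Nonemptiness makes the infimum meaningful.\<close>

lemma T_time_greater:
  assumes "isCont X t" "0 < r" "times_after X \<tau> t r \<noteq> {}"
  shows "t < T_time X \<tau> r t"
proof -
  obtain d where d: "0 < d" "\<And>s. \<bar>s - t\<bar> < d \<Longrightarrow> cmod (X s - X t) < r"
    using isCont_close[OF assms(1,2)] by blast
  have "t + d \<le> T_time X \<tau> r t"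
    unfolding T_time_def
  proof (rule cInf_greatest[OF assms(3)])
    fix s assume "s \<in> times_after X \<tau> t r"
    then show "t + d \<le> s"
      using d(2)[of s] by (force simp: times_after_def)
  qed
  then show ?thesis using d(1) by simp
qed

lemma S_time_less:
  assumes "isCont X t" "0 < r" "times_before X t r \<noteq> {}"
  shows "S_time X r t < t"
proof -
  obtain d where d: "0 < d" "\<And>s. \<bar>s - t\<bar> < d \<Longrightarrow> cmod (X s - X t) < r"
    using isCont_close[OF assms(1,2)] by blast
  have "S_time X r t \<le> t - d"
    unfolding S_time_def
  proof (rule cSup_least[OF assms(3)])
    fix s assume "s \<in> times_before X t r"
    then show "s \<le> t - d"
      using d(2)[of s] by (force simp: times_before_def)
  qed
  then show ?thesis using d(1) by simp
qed

section \<open>Sequential description of \<open>Z_tilde\<close>\<close>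

context
  fixes X :: "real \<Rightarrow> complex" and \<tau> :: ereal and t :: real
  assumes cont: "continuous_on (lifetime_interval \<tau>) X"
    and t: "0 < t" "ereal t < \<tau>"
    and nonconst: "nonconstant_near X t"
begin

text \<open>This expresses that \<open>T_time\<close> and \<open>S_time\<close> tend to
  \<open>t\<close> as the radius tends to 0, and it is the point where nonconstancy enters. Points
  \<open>v\<close> after and \<open>u\<close> before \<open>t\<close>, close to \<open>t\<close> and
  with values other than \<open>X t\<close>, force every smaller radius to be attained between them
  and \<open>t\<close>.\<close>

lemma small_radius:
  assumes "a < t" "t < b"
  obtains r where "0 < r"
    "\<And>\<epsilon>. \<lbrakk>0 < \<epsilon>; \<epsilon> \<le> r\<rbrakk> \<Longrightarrow> times_after X \<tau> t \<epsilon> \<noteq> {} \<and> T_time X \<tau> \<epsilon> t < b"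
    "\<And>\<epsilon>. \<lbrakk>0 < \<epsilon>; \<epsilon> \<le> r\<rbrakk> \<Longrightarrow> times_before X t \<epsilon> \<noteq> {} \<and> a < S_time X \<epsilon> t"
proof -
  obtain b' where b': "t < b'" "ereal b' < \<tau>"
    using ereal_dense2[OF t(2)] by auto
  obtain v where v: "t < v" "v < min b b'" "X v \<noteq> X t"
    using nonconst assms(2) b' unfolding nonconstant_near_def
    by (metis greaterThanLessThan_iff min_less_iff_conj)
  obtain u where u: "max a 0 < u" "u < t" "X u \<noteq> X t"
    using nonconst assms(1) t(1) unfolding nonconstant_near_def
    by (metis greaterThanLessThan_iff max_less_iff_conj)
  have v\<tau>: "ereal v < \<tau>"
    using v b' by (simp add: less_trans[of _ "ereal b'"])
  have cv: "continuous_on {t..v} X" and cu: "continuous_on {u..t} X"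
    using continuous_on_subset[OF cont lifetime_interval_between] v\<tau> t u by auto
  \<comment> \<open>Radii up to the smaller of the two displacements are attained on both
    \<open>{t..v}\<close> and \<open>{u..t}\<close>.\<close>
  define r where "r = min (cmod (X v - X t)) (cmod (X u - X t))"
  show thesis
  proof (rule that[of r])
    show "0 < r" using u v by (simp add: r_def)
    show "times_after X \<tau> t \<epsilon> \<noteq> {} \<and> T_time X \<tau> \<epsilon> t < b" if "0 < \<epsilon>" "\<epsilon> \<le> r" for \<epsilon>
      using times_after_within[OF cv v(1) v\<tau>, of \<epsilon>] v that by (auto simp: r_def)
    show "times_before X t \<epsilon> \<noteq> {} \<and> a < S_time X \<epsilon> t" if "0 < \<epsilon>" "\<epsilon> \<le> r" for \<epsilon>
      using times_before_within[OF cu u(2), of \<epsilon>] u that by (auto simp: r_def)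
  qed
qed

lemma T_time_before_lifetime:
  assumes "times_after X \<tau> t r \<noteq> {}"
  shows "ereal (T_time X \<tau> r t) < \<tau>"
proof -
  obtain s where s: "s \<in> times_after X \<tau> t r" using assms by auto
  have "bdd_below (times_after X \<tau> t r)"
    by (rule bdd_belowI[of _ t]) (auto simp: times_after_def)
  then have "T_time X \<tau> r t \<le> s"
    using cInf_lower[OF s] unfolding T_time_def by auto
  then show ?thesis
    using s by (auto simp: times_after_def intro: le_less_trans[of _ "ereal s"])
qed

lemma S_time_nonneg:
  assumes "times_before X t r \<noteq> {}"
  shows "0 \<le> S_time X r t"
proof -
  obtain s where s: "s \<in> times_before X t r" using assms by auto
  have "bdd_above (times_before X t r)"
    by (rule bdd_aboveI[of _ t]) (auto simp: times_before_def)
  then have "s \<le> S_time X r t"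
    using cSup_upper[OF s] unfolding S_time_def by auto
  then show ?thesis
    using s by (auto simp: times_before_def)
qed

text \<open>The inner radius is free, so any \<open>s > t\<close> and \<open>s' < t\<close> respect
  the inner bounds once that radius is small enough. Only the outer bounds remain as
  constraints.\<close>

lemma Z_set_memI:
  assumes "0 < R" "t < s" "s \<le> T_time X \<tau> R t" "S_time X R t \<le> s'" "s' < t" "X s' \<noteq> X t"
  shows "(X s - X t) / (X s' - X t) \<in> Z_set X \<tau> R t"
proof -
  obtain r where r: "0 < r"
    "\<And>\<epsilon>. \<lbrakk>0 < \<epsilon>; \<epsilon> \<le> r\<rbrakk> \<Longrightarrow> times_after X \<tau> t \<epsilon> \<noteq> {} \<and> T_time X \<tau> \<epsilon> t < s"
    "\<And>\<epsilon>. \<lbrakk>0 < \<epsilon>; \<epsilon> \<le> r\<rbrakk> \<Longrightarrow> times_before X t \<epsilon> \<noteq> {} \<and> s' < S_time X \<epsilon> t"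
    using small_radius[OF \<open>s' < t\<close> \<open>t < s\<close>] by blast
  \<comment> \<open>The bound \<open>r\<close> puts the inner hitting times between
    \<open>s'\<close> and \<open>s\<close>; the bound \<open>R / 2\<close> makes the inner radius
    strictly smaller than \<open>R\<close>.\<close>
  define \<epsilon> where "\<epsilon> = min r (R / 2)"
  have \<epsilon>: "0 < \<epsilon>" "\<epsilon> \<le> r" "\<epsilon> < R"
    using r(1) assms(1) by (auto simp: \<epsilon>_def)
  have "T_time X \<tau> \<epsilon> t < s" "s' < S_time X \<epsilon> t"
    using r \<epsilon> by auto
  then show ?thesis
    unfolding Z_set_def using \<epsilon> assms by (intro UN_I[of \<epsilon>]) (auto intro!: less_imp_le)
qed

lemma Z_set_memE:
  assumes "z \<in> Z_set X \<tau> R t" "times_after X \<tau> t R \<noteq> {}" "times_before X t R \<noteq> {}"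
  obtains s s' where "t < s" "s \<le> T_time X \<tau> R t" "S_time X R t \<le> s'" "s' < t" "X s' \<noteq> X t"
    "z = (X s - X t) / (X s' - X t)"
proof -
  obtain \<epsilon> s s' where \<epsilon>: "0 < \<epsilon>" "\<epsilon> < R" "T_time X \<tau> \<epsilon> t \<le> s" "s \<le> T_time X \<tau> R t"
    "S_time X R t \<le> s'" "s' \<le> S_time X \<epsilon> t" "X s' \<noteq> X t" "z = (X s - X t) / (X s' - X t)"
    using assms(1) unfolding Z_set_def by auto
  have isC: "isCont X t"
    using isCont_of_continuous_lifetime[OF cont t] .
  \<comment> \<open>Radius \<open>R\<close> is attained on both sides, so the intermediate value
    theorem gives the same for the inner radius \<epsilon>. Thus its hitting times are not the
    infimum or supremum of an empty set, and they are separated from \<open>t\<close>.\<close>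
  obtain v where v: "t < v" "ereal v < \<tau>" "cmod (X v - X t) = R"
    using assms(2) by (auto simp: times_after_def)
  obtain u where u: "0 \<le> u" "u < t" "cmod (X u - X t) = R"
    using assms(3) by (auto simp: times_before_def)
  have "continuous_on {t..v} X" "continuous_on {u..t} X"
    using continuous_on_subset[OF cont lifetime_interval_between] v t u by auto
  then have "times_after X \<tau> t \<epsilon> \<noteq> {}" "times_before X t \<epsilon> \<noteq> {}"
    using times_after_within(1) times_before_within(1) u v \<epsilon> by auto
  then have "t < s" "s' < t"
    using T_time_greater[OF isC \<epsilon>(1)] S_time_less[OF isC \<epsilon>(1)] \<epsilon> by force+
  then show thesis using that \<epsilon> by blast
qed

text \<open>Forwards, a small radius confines both times to any given neighbourhood of
  \<open>t\<close>. Backwards, \<open>T_time\<close> and \<open>S_time\<close> at a fixed radius are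
  separated from \<open>t\<close>, so a tail of the quotients lies in each \<open>Z_set\<close>.
  Membership in the lifetime is recorded because there the values of the path can be controlled when
  a map is applied.\<close>

lemma mem_Z_tilde_iff:
  "z \<in> Z_tilde X \<tau> t \<longleftrightarrow>
     (\<exists>s s'. (\<forall>n. t < s n \<and> s n \<in> lifetime_interval \<tau> \<and>
          s' n < t \<and> s' n \<in> lifetime_interval \<tau> \<and> X (s' n) \<noteq> X t) \<and>
        s \<longlonglongrightarrow> t \<and> s' \<longlonglongrightarrow> t \<and> (\<lambda>n. (X (s n) - X t) / (X (s' n) - X t)) \<longlonglongrightarrow> z)"
  (is "_ \<longleftrightarrow> (\<exists>s s'. ?lim s s')")
proof
  assume z: "z \<in> Z_tilde X \<tau> t"
  \<comment> \<open>A single scale \<open>d\<close> bounds the distances of both times to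
    \<open>t\<close> and of the quotient to \<open>z\<close>; taking \<open>d = 1 / Suc n\<close>
    then yields all three limits at once.\<close>
  have "\<exists>s s'. t < s \<and> s < t + d \<and> s \<in> lifetime_interval \<tau> \<and> t - d < s' \<and> s' < t \<and>
      s' \<in> lifetime_interval \<tau> \<and> X s' \<noteq> X t \<and> dist ((X s - X t) / (X s' - X t)) z < d"
    if "0 < d" for d
  proof -
    obtain r where r: "0 < r" "times_after X \<tau> t r \<noteq> {}" "T_time X \<tau> r t < t + d"
      "times_before X t r \<noteq> {}" "t - d < S_time X r t"
      using small_radius[of "t - d" "t + d"] \<open>0 < d\<close>
      by (metis add.commute diff_less_eq less_add_same_cancel1 order_refl)
    then have "z \<in> closure (Z_set X \<tau> r t)"
      using z unfolding Z_tilde_def by blast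
    then obtain w where w: "w \<in> Z_set X \<tau> r t" "dist w z < d"
      using \<open>0 < d\<close> unfolding closure_approachable by blast
    obtain s s' where s: "t < s" "s \<le> T_time X \<tau> r t" "S_time X r t \<le> s'" "s' < t" "X s' \<noteq> X t"
      "w = (X s - X t) / (X s' - X t)"
      using Z_set_memE[OF w(1)] r by blast
    have "{S_time X r t..T_time X \<tau> r t} \<subseteq> lifetime_interval \<tau>"
      using lifetime_interval_between S_time_nonneg T_time_before_lifetime r by blast
    then have "s \<in> lifetime_interval \<tau>" "s' \<in> lifetime_interval \<tau>"
      using s by auto
    then show ?thesis using s w r by (intro exI[of _ s] exI[of _ s']) auto
  qed
  then have "\<forall>n. \<exists>s s'. t < s \<and> s < t + 1 / Suc n \<and> s \<in> lifetime_interval \<tau> \<and>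
      t - 1 / Suc n < s' \<and> s' < t \<and> s' \<in> lifetime_interval \<tau> \<and> X s' \<noteq> X t \<and>
      dist ((X s - X t) / (X s' - X t)) z < 1 / Suc n"
    by simp
  then obtain s s' where ss: "\<And>n. t < s n \<and> s n < t + 1 / Suc n \<and> s n \<in> lifetime_interval \<tau> \<and>
      t - 1 / Suc n < s' n \<and> s' n < t \<and> s' n \<in> lifetime_interval \<tau> \<and> X (s' n) \<noteq> X t \<and>
      dist ((X (s n) - X t) / (X (s' n) - X t)) z < 1 / Suc n"
    by metis
  have lim0: "(\<lambda>n. 1 / Suc n) \<longlonglongrightarrow> (0::real)"
    using LIMSEQ_inverse_real_of_nat by (simp add: inverse_eq_divide)
  have close: "f \<longlonglongrightarrow> l" if "\<And>n. dist (f n) l \<le> 1 / Suc n"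
    for f :: "nat \<Rightarrow> 'b::metric_space" and l
    by (rule metric_tendsto_imp_tendsto[OF lim0]) (use that in auto)
  have "s \<longlonglongrightarrow> t" "s' \<longlonglongrightarrow> t" "(\<lambda>n. (X (s n) - X t) / (X (s' n) - X t)) \<longlonglongrightarrow> z"
    using ss by (intro close; smt (verit) dist_real_def)+
  then show "\<exists>s s'. ?lim s s'"
    using ss by blast
next
  assume "\<exists>s s'. ?lim s s'"
  then obtain s s' where ss: "?lim s s'" by blast
  have isC: "isCont X t"
    using isCont_of_continuous_lifetime[OF cont t] .
  show "z \<in> Z_tilde X \<tau> t"
    unfolding Z_tilde_def
  proof (rule INT_I)
    fix R
    assume "R \<in> {R. 0 < R \<and> times_after X \<tau> t R \<noteq> {} \<and> times_before X t R \<noteq> {}}"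
    then have R: "0 < R" "times_after X \<tau> t R \<noteq> {}" "times_before X t R \<noteq> {}"
      by auto
    have "eventually (\<lambda>n. s n < T_time X \<tau> R t) sequentially"
      using ss T_time_greater[OF isC R(1)] R(2) by (intro order_tendstoD(2)[of s t]) auto
    moreover have "eventually (\<lambda>n. S_time X R t < s' n) sequentially"
      using ss S_time_less[OF isC R(1)] R(3) by (intro order_tendstoD(1)[of s' t]) auto
    ultimately have "eventually (\<lambda>n. (X (s n) - X t) / (X (s' n) - X t) \<in>
        closure (Z_set X \<tau> R t)) sequentially"
    proof eventually_elim
      case (elim n)
      then show ?case
        using ss R(1) by (intro subsetD[OF closure_subset] Z_set_memI) auto
    qed
    moreover have "(\<lambda>n. (X (s n) - X t) / (X (s' n) - X t)) \<longlonglongrightarrow> z"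
      using ss by simp
    ultimately show "z \<in> closure (Z_set X \<tau> R t)"
      by (rule Lim_in_closed_set[OF closed_closure _ sequentially_bot])
  qed
qed

end

section \<open>Conformal maps along a path inside the domain\<close>

lemma Z_tilde_conformal_image:
  assumes X: "continuous_on (lifetime_interval \<tau>) X" "nonconstant_near X t"
    and t: "0 < t" "ereal t < \<tau>"
    and range: "X ` lifetime_interval \<tau> \<subseteq> \<Omega>"
    and \<Phi>: "open \<Omega>" "\<Phi> holomorphic_on \<Omega>" "inj_on \<Phi> \<Omega>"
  shows "Z_tilde (\<lambda>s. \<Phi> (X s)) \<tau> t = Z_tilde X \<tau> t"
proof -
  define I where "I = lifetime_interval \<tau>"
  have tI: "t \<in> I" using t by (simp add: I_def lifetime_interval_def)
  have in\<Omega>: "X s \<in> \<Omega>" if "s \<in> I" for s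
    using range that by (auto simp: I_def)
  have eq_iff: "\<Phi> (X s) = \<Phi> (X t) \<longleftrightarrow> X s = X t" if "s \<in> I" for s
    using inj_on_eq_iff[OF \<Phi>(3) in\<Omega>[OF that] in\<Omega>[OF tI]] .
  obtain b where b: "t < b" "ereal b < \<tau>"
    using ereal_dense2[OF t(2)] by auto
  have near: "{0..b} \<subseteq> I"
    using lifetime_interval_between b by (simp add: I_def)
  have contY: "continuous_on (lifetime_interval \<tau>) (\<lambda>s. \<Phi> (X s))"
    using continuous_on_compose2[OF holomorphic_on_imp_continuous_on[OF \<Phi>(2)] X(1) range] .
  \<comment> \<open>The witnesses are chosen in \<open>{0..b}\<close>, hence within the lifetime,
    where the path lies in \<Omega> and injectivity of \<Phi> keeps distinct values
    distinct.\<close>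
  have nonconstY: "nonconstant_near (\<lambda>s. \<Phi> (X s)) t"
    unfolding nonconstant_near_def
  proof safe
    fix u assume "t < u"
    then obtain s where "t < s" "s < min u b" "X s \<noteq> X t"
      using X(2) b(1) unfolding nonconstant_near_def
      by (metis greaterThanLessThan_iff min_less_iff_conj)
    then show "\<exists>s\<in>{t<..<u}. \<Phi> (X s) \<noteq> \<Phi> (X t)"
      using eq_iff[of s] subsetD[OF near, of s] t by (intro bexI[of _ s]) auto
  next
    fix u assume "u < t"
    then obtain s where "max u 0 < s" "s < t" "X s \<noteq> X t"
      using X(2) t(1) unfolding nonconstant_near_def
      by (metis greaterThanLessThan_iff max_less_iff_conj)
    then show "\<exists>s\<in>{u<..<t}. \<Phi> (X s) \<noteq> \<Phi> (X t)"
      using eq_iff[of s] subsetD[OF near, of s] b by (intro bexI[of _ s]) auto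
  qed
  have deriv: "(\<Phi> has_field_derivative deriv \<Phi> (X t)) (at (X t))"
    using holomorphic_derivI[OF \<Phi>(2,1) in\<Omega>[OF tI]] .
  have c: "deriv \<Phi> (X t) \<noteq> 0"
    using holomorphic_injective_imp_regular[OF \<Phi>(2,1,3) in\<Omega>[OF tI]] .
  \<comment> \<open>Caratheodory's form of the derivative turns increments of \<Phi> into exact
    products, with no remainder term.\<close>
  obtain g where g: "\<And>z. \<Phi> z - \<Phi> (X t) = g z * (z - X t)" "isCont g (X t)"
    "g (X t) = deriv \<Phi> (X t)"
    using deriv unfolding CARAT_DERIV by blast
  \<comment> \<open>At \<open>X t\<close> the factor is the nonzero derivative; elsewhere on the
    path a zero of it would contradict injectivity.\<close>
  have g_nonzero: "g (X s) \<noteq> 0" if "s \<in> I" for s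
    using g(1)[of "X s"] g(3) c eq_iff[OF that] by (cases "X s = X t") auto
  have isC: "isCont X t"
    using isCont_of_continuous_lifetime[OF X(1) t] .
  have g_lim: "(\<lambda>n. g (X (s n))) \<longlonglongrightarrow> deriv \<Phi> (X t)" if "s \<longlonglongrightarrow> t" for s :: "nat \<Rightarrow> real"
    using isCont_tendsto_compose[OF g(2) isCont_tendsto_compose[OF isC that]] g(3) by simp
  \<comment> \<open>The two quotients differ by a ratio of values of \<open>g\<close>, both tending
    to the derivative at \<open>X t\<close>. Multiplying by this ratio or its inverse, each with
    limit 1, gives the two directions.\<close>
  have quot: "(\<lambda>n. (\<Phi> (X (s n)) - \<Phi> (X t)) / (\<Phi> (X (s' n)) - \<Phi> (X t))) \<longlonglongrightarrow> z \<longleftrightarrow>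
      (\<lambda>n. (X (s n) - X t) / (X (s' n) - X t)) \<longlonglongrightarrow> z" (is "?Y \<longlonglongrightarrow> z \<longleftrightarrow> ?X \<longlonglongrightarrow> z")
    if s: "\<And>n. s n \<in> I" "\<And>n. s' n \<in> I" "s \<longlonglongrightarrow> t" "s' \<longlonglongrightarrow> t" for s s' z
  proof
    assume "?X \<longlonglongrightarrow> z"
    then have "(\<lambda>n. g (X (s n)) / g (X (s' n)) * ?X n) \<longlonglongrightarrow>
        deriv \<Phi> (X t) / deriv \<Phi> (X t) * z"
      by (intro tendsto_intros g_lim s c)
    then show "?Y \<longlonglongrightarrow> z"
      using c by (simp add: g(1))
  next
    assume "?Y \<longlonglongrightarrow> z"
    then have "(\<lambda>n. g (X (s' n)) / g (X (s n)) * ?Y n) \<longlonglongrightarrow>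
        deriv \<Phi> (X t) / deriv \<Phi> (X t) * z"
      by (intro tendsto_intros g_lim s c)
    then show "?X \<longlonglongrightarrow> z"
      using c g_nonzero[OF s(1)] g_nonzero[OF s(2)] by (simp add: g(1))
  qed
  show ?thesis
  proof (rule set_eqI)
    fix z
    show "z \<in> Z_tilde (\<lambda>s. \<Phi> (X s)) \<tau> t \<longleftrightarrow> z \<in> Z_tilde X \<tau> t"
      unfolding mem_Z_tilde_iff[OF contY t nonconstY] mem_Z_tilde_iff[OF X(1) t X(2)]
        I_def[symmetric]
      using eq_iff quot by meson
  qed
qed

text \<open>A path segment from a point of \<Omega> to a point outside is connected and so meets the
  frontier, at a time no later than \<open>u\<close>. This contradicts \<open>u\<close> being before
  the first hitting time.\<close>

lemma path_before_hitting_frontier: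
  fixes X :: "real \<Rightarrow> complex"
  assumes "continuous_on {0..} X" "X 0 \<in> \<Omega>"
  shows "X ` lifetime_interval (first_hitting_time X (frontier \<Omega>)) \<subseteq> \<Omega>"
proof (rule image_subsetI, rule ccontr)
  fix u assume u: "u \<in> lifetime_interval (first_hitting_time X (frontier \<Omega>))" and "X u \<notin> \<Omega>"
  have "connected (X ` {0..u})"
    using assms(1) by (intro connected_continuous_image) (auto elim: continuous_on_subset)
  moreover have "0 \<le> u"
    using u by (simp add: lifetime_interval_def)
  ultimately have "X ` {0..u} \<inter> frontier \<Omega> \<noteq> {}"
    using assms(2) \<open>X u \<notin> \<Omega>\<close> \<open>0 \<le> u\<close>
    by (intro connected_Int_frontier) (force intro: imageI[of _ "{0..u}" X])+
  then obtain s where s: "0 \<le> s" "s \<le> u" "X s \<in> frontier \<Omega>"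
    by auto
  then have "first_hitting_time X (frontier \<Omega>) \<le> ereal s"
    unfolding first_hitting_time_def by (intro Inf_lower) auto
  also have "\<dots> \<le> ereal u" using s by simp
  finally show False
    using u by (simp add: lifetime_interval_def leD)
qed

section \<open>Almost sure properties of Brownian paths\<close>

context planar_brownian_motion
begin

text \<open>The increment has a density with respect to Lebesgue measure, so it gives no mass to the
  point 0.\<close>

lemma AE_increment_nonzero:
  assumes "0 \<le> s" "s < t"
  shows "AE \<omega> in M. B t \<omega> \<noteq> B s \<omega>"
proof -
  let ?D = "\<lambda>\<omega>. B t \<omega> - B s \<omega>"
  let ?f = "\<lambda>z. ennreal (exp (- (cmod z)\<^sup>2 / (2 * (t - s))) / (2 * pi * (t - s)))"
  have D: "distributed M lborel ?D ?f"
    using gaussian_increments[OF assms] .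
  have "AE z in density lborel ?f. z \<noteq> 0"
    using distributed_borel_measurable[OF D] AE_lborel_singleton[of "0::complex"]
    by (subst AE_density) auto
  then have "AE z in distr M lborel ?D. z \<noteq> 0"
    by (simp only: distributed_distr_eq_density[OF D])
  then have "AE \<omega> in M. ?D \<omega> \<noteq> 0"
    by (rule AE_distrD[OF distributed_measurable[OF D]])
  then show ?thesis by simp
qed

lemma AE_nonconstant: "AE \<omega> in M. \<forall>t>0. nonconstant_near (\<lambda>t. B t \<omega>) t"
proof -
  \<comment> \<open>Restricting to rational times leaves countably many null sets, whose union is
    null; density of the rationals then handles all real \<open>t\<close> on one event.\<close>
  have "AE \<omega> in M. \<forall>p q :: rat. 0 \<le> p \<and> p < q \<longrightarrow>
      B (real_of_rat q) \<omega> \<noteq> B (real_of_rat p) \<omega>"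
    unfolding AE_all_countable
    by (auto intro!: AE_impI AE_increment_nonzero simp: of_rat_less)
  then show ?thesis
  proof eventually_elim
    case (elim \<omega>)
    \<comment> \<open>Two rational times in the interval carry different values, so at least one of
      these differs from \<open>B t \<omega>\<close>.\<close>
    have *: "\<exists>s\<in>{a<..<b}. B s \<omega> \<noteq> B t \<omega>" if "0 \<le> a" "a < b" for a b t
    proof -
      obtain q where q: "a < real_of_rat q" "real_of_rat q < b"
        using of_rat_dense[OF \<open>a < b\<close>] by blast
      obtain p where p: "a < real_of_rat p" "real_of_rat p < real_of_rat q"
        using of_rat_dense[OF q(1)] by blast
      have "0 < real_of_rat p" using that p by linarith
      then have "B (real_of_rat q) \<omega> \<noteq> B (real_of_rat p) \<omega>"
        using elim p by (simp add: of_rat_less)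
      then show ?thesis
        using p q by (metis greaterThanLessThan_iff less_trans)
    qed
    show ?case
      unfolding nonconstant_near_def
    proof safe
      fix t u :: real assume "0 < t" "t < u"
      then show "\<exists>s\<in>{t<..<u}. B s \<omega> \<noteq> B t \<omega>" using *[of t u] by simp
    next
      fix t u :: real assume "0 < t" "u < t"
      then show "\<exists>s\<in>{u<..<t}. B s \<omega> \<noteq> B t \<omega>" using *[of "max u 0" t t] by force
    qed
  qed
qed

end

theorem proposition3:
  fixes A \<Omega> :: "complex set" and \<Phi> :: "complex \<Rightarrow> complex"
    and M :: "'w measure" and B :: "real \<Rightarrow> 'w \<Rightarrow> complex"
  assumes "open \<Omega>" and "0 \<in> \<Omega>"
    and "\<Phi> holomorphic_on \<Omega>" and "inj_on \<Phi> \<Omega>" and "\<Phi> 0 = 0"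
    and "planar_brownian_motion M B"
  shows "AE \<omega> in M.
    strongly_exceptional_points A (\<lambda>t. \<Phi> (B t \<omega>))
        (first_hitting_time (\<lambda>t. B t \<omega>) (frontier \<Omega>)) =
    \<Phi> ` strongly_exceptional_points A (\<lambda>t. B t \<omega>)
        (first_hitting_time (\<lambda>t. B t \<omega>) (frontier \<Omega>))"
proof -
  interpret planar_brownian_motion M B by fact
  show ?thesis
    using starts_at_0 continuous_paths AE_nonconstant
  proof eventually_elim
    case (elim \<omega>)
    let ?X = "\<lambda>t. B t \<omega>"
    let ?\<tau> = "first_hitting_time ?X (frontier \<Omega>)"
    have cont: "continuous_on (lifetime_interval ?\<tau>) ?X"
      using elim(2) by (rule continuous_on_subset) (auto simp: lifetime_interval_def)
    have range: "?X ` lifetime_interval ?\<tau> \<subseteq> \<Omega>"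
      using elim(1) assms(2) by (intro path_before_hitting_frontier elim(2)) simp
    \<comment> \<open>The image path keeps the time parametrization and lifetime of the original.
      Equality of the two limit sets at each time therefore selects the same exceptional times for
      both paths, and their positions correspond under \<Phi>.\<close>
    have "Z_tilde (\<lambda>s. \<Phi> (?X s)) ?\<tau> t = Z_tilde ?X ?\<tau> t" if "0 < t" "ereal t < ?\<tau>" for t
      using elim(3) that by (intro Z_tilde_conformal_image[OF cont _ that range assms(1,3,4)]) simp
    then show ?case
      unfolding strongly_exceptional_points_def by (auto simp: image_iff) blast+
  qed
qed

end
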